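(* Let $S=\langle a,a+1,a+2\rangle\subset\mathbb{N}$ where $a\in\mathbb{N}$, $2<a$ and $a=2q+2$ for some $q\in\mathbb{N}$, and let $\mathcal{A}=\{a,a+1,a+2\}$. Then, for any $w\in\mathbb{N}^3\setminus\{(0,0,0)\}$, the ideal $I_{\mathcal{A}_w}$ is uniquely presented.
   Context: $\mathbb{N}$ contains $0$ and $\mathbb{K}$ is a field. For $w=(w_1,w_2,w_3)$, $\mathcal{A}_w:=\{(a,w_1),(a+1,w_2),(a+2,w_3),(0,1)\}\subset\mathbb{Z}^2$. The toric ideal $I_{\mathcal{A}_w}\subset\mathbb{K}[x,y,z,t]$ is the kernel of the $\mathbb{K}$-algebra map to $\mathbb{K}[s_1^{\pm1},s_2^{\pm1}]$ given by $x\mapsto s_1^{a}s_2^{w_1}$, $y\mapsto s_1^{a+1}s_2^{w_2}$, $z\mapsto s_1^{a+2}s_2^{w_3}$, $t\mapsto s_2$. A toric ideal is uniquely presented if it has a unique minimal generating set of binomials, up to scalar multiplication. *)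

theory Defs
  imports Complex_Main "HOL-Library.Poly_Mapping" "HOL-Library.Product_Plus"
begin

text \<open>
  The type \<^typ>\<open>('v \<Rightarrow>\<^sub>0 nat) \<Rightarrow>\<^sub>0 'k\<close> with its convolution product is the polynomial
  ring over \<open>'k\<close> in the variables \<open>'v\<close>: exponent vectors are mapped to coefficients.
  In the same way \<^typ>\<open>(int \<times> int) \<Rightarrow>\<^sub>0 'k\<close> is the ring of Laurent polynomials in two
  variables \<open>s\<^sub>1\<close>, \<open>s\<^sub>2\<close>, where \<open>single (i, j) c\<close> is \<open>c s\<^sub>1\<^sup>i s\<^sub>2\<^sup>j\<close>.
\<close>

type_synonym ('v, 'k) mpoly = "('v \<Rightarrow>\<^sub>0 nat) \<Rightarrow>\<^sub>0 'k"
type_synonym 'k laurent2 = "(int \<times> int) \<Rightarrow>\<^sub>0 'k"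

definition poly_var :: "'v \<Rightarrow> ('v, 'k::field) mpoly" where
  "poly_var v = Poly_Mapping.single (Poly_Mapping.single v 1) 1"

definition toric_map :: "('v \<Rightarrow> int \<times> int) \<Rightarrow> ('v, 'k::field) mpoly \<Rightarrow> 'k laurent2" where
  "toric_map A p =
     (\<Sum>m\<in>Poly_Mapping.keys p.
        Poly_Mapping.single 0 (Poly_Mapping.lookup p m) *
        (\<Prod>v\<in>Poly_Mapping.keys m. Poly_Mapping.single (A v) 1 ^ Poly_Mapping.lookup m v))"

definition toric_ideal :: "('v \<Rightarrow> int \<times> int) \<Rightarrow> ('v, 'k::field) mpoly set" where
  "toric_ideal A = {p. toric_map A p = 0}"

text \<open>The ideal generated by a set: its linear span, with ring elements as coefficients.\<close>

definition ideal_gen :: "'r::comm_ring_1 set \<Rightarrow> 'r set" where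
  "ideal_gen G = module.span (*) G"

text \<open>
  A binomial is a polynomial with exactly two terms. No condition on the two coefficients is
  needed: the binomials in a toric ideal are scalar multiples of differences of two monomials.
\<close>

definition is_binomial :: "('v, 'k::field) mpoly \<Rightarrow> bool" where
  "is_binomial p \<longleftrightarrow> card (Poly_Mapping.keys p) = 2"

definition binomial_generating_set ::
    "('v, 'k::field) mpoly set \<Rightarrow> ('v, 'k) mpoly set \<Rightarrow> bool" where
  "binomial_generating_set I G \<longleftrightarrow> (\<forall>g\<in>G. is_binomial g) \<and> ideal_gen G = I"

text \<open>Minimality is with respect to inclusion.\<close>

definition minimal_binomial_generating_set ::
    "('v, 'k::field) mpoly set \<Rightarrow> ('v, 'k) mpoly set \<Rightarrow> bool" where
  "minimal_binomial_generating_set I G \<longleftrightarrow>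
     binomial_generating_set I G \<and> (\<forall>H. H \<subset> G \<longrightarrow> ideal_gen H \<noteq> I)"

definition scalar_multiples :: "('v, 'k::field) mpoly set \<Rightarrow> ('v, 'k) mpoly set" where
  "scalar_multiples G = {Poly_Mapping.single 0 c * g | c g. c \<noteq> 0 \<and> g \<in> G}"

text \<open>
  Two sets agree up to scalar multiplication of their elements if they have the same nonzero
  scalar multiples. A minimal generating set never contains two proportional elements, so for
  minimal generating sets this amounts to a bijection between them that rescales each element.
\<close>

definition uniquely_presented :: "('v, 'k::field) mpoly set \<Rightarrow> bool" where
  "uniquely_presented I \<longleftrightarrow>
     (\<exists>G. minimal_binomial_generating_set I G \<and>
        (\<forall>H. minimal_binomial_generating_set I H \<longrightarrow>
           scalar_multiples H = scalar_multiples G))"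

datatype var = X | Y | Z | T

text \<open>
  The vectors of \<open>\<A>\<^sub>w\<close>, each labelled by the variable that is sent to the corresponding
  Laurent monomial.
\<close>

fun \<A> :: "nat \<Rightarrow> nat \<times> nat \<times> nat \<Rightarrow> var \<Rightarrow> int \<times> int" where
  "\<A> a (w1, w2, w3) X = (int a, int w1)"
| "\<A> a (w1, w2, w3) Y = (int (a + 1), int w2)"
| "\<A> a (w1, w2, w3) Z = (int (a + 2), int w3)"
| "\<A> a (w1, w2, w3) T = (0, 1)"

text \<open>
  The explicit formula for \<^const>\<open>toric_map\<close> does define the \<open>'k\<close>-algebra homomorphism with
  the prescribed values on the variables.
\<close>

lemma toric_map_superset:
  assumes "finite M" "Poly_Mapping.keys p \<subseteq> M"
  shows "toric_map A p =
     (\<Sum>m\<in>M. Poly_Mapping.single 0 (Poly_Mapping.lookup p m) *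
        (\<Prod>v\<in>Poly_Mapping.keys m. Poly_Mapping.single (A v) 1 ^ Poly_Mapping.lookup m v))"
  unfolding toric_map_def using assms
  by (intro sum.mono_neutral_left) (auto simp: in_keys_iff)

lemma toric_map_add: "toric_map A (p + q) = toric_map A p + toric_map A q"
proof -
  let ?M = "Poly_Mapping.keys p \<union> Poly_Mapping.keys q"
  have "Poly_Mapping.keys (p + q) \<subseteq> ?M" by (rule keys_add)
  then show ?thesis
    by (simp add: toric_map_superset[of ?M] lookup_add single_add distrib_right sum.distrib)
qed

lemma toric_map_single:
  "toric_map A (Poly_Mapping.single m c) = Poly_Mapping.single 0 c *
     (\<Prod>v\<in>Poly_Mapping.keys m. Poly_Mapping.single (A v) 1 ^ Poly_Mapping.lookup m v)"
  by (subst toric_map_superset[of "{m}"]) auto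

lemma toric_map_const: "toric_map A (Poly_Mapping.single 0 c) = Poly_Mapping.single 0 c"
  by (simp add: toric_map_single)

lemma toric_map_var: "toric_map A (poly_var v) = Poly_Mapping.single (A v) 1"
  by (simp add: poly_var_def toric_map_single)

lemma monom_image_add:
  fixes f :: "'v \<Rightarrow> 'r::comm_monoid_mult"
  shows "(\<Prod>v\<in>Poly_Mapping.keys (m + n). f v ^ Poly_Mapping.lookup (m + n) v) =
    (\<Prod>v\<in>Poly_Mapping.keys m. f v ^ Poly_Mapping.lookup m v) *
    (\<Prod>v\<in>Poly_Mapping.keys n. f v ^ Poly_Mapping.lookup n v)"
proof -
  let ?V = "Poly_Mapping.keys m \<union> Poly_Mapping.keys n"
  have *: "(\<Prod>v\<in>Poly_Mapping.keys k. f v ^ Poly_Mapping.lookup k v) =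
      (\<Prod>v\<in>?V. f v ^ Poly_Mapping.lookup k v)" if "Poly_Mapping.keys k \<subseteq> ?V" for k
    using that by (intro prod.mono_neutral_left) (auto simp: in_keys_iff)
  have "Poly_Mapping.keys (m + n) \<subseteq> ?V" by (rule keys_add)
  then have "(\<Prod>v\<in>Poly_Mapping.keys (m + n). f v ^ Poly_Mapping.lookup (m + n) v) =
      (\<Prod>v\<in>?V. f v ^ Poly_Mapping.lookup m v) * (\<Prod>v\<in>?V. f v ^ Poly_Mapping.lookup n v)"
    by (subst *) (simp_all add: lookup_add power_add prod.distrib)
  then show ?thesis
    by (simp only: *[of m] *[of n] Un_upper1 Un_upper2)
qed

lemma toric_map_sum: "toric_map A (sum f S) = (\<Sum>i\<in>S. toric_map A (f i))"
  by (induction S rule: infinite_finite_induct) (auto simp: toric_map_add toric_map_def[of A 0])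

lemma poly_as_sum:
  "p = (\<Sum>m\<in>Poly_Mapping.keys p. Poly_Mapping.single m (Poly_Mapping.lookup p m))"
  by (rule poly_mapping_eqI)
     (auto simp: lookup_sum lookup_single when_def in_keys_iff)

lemma toric_map_mult: "toric_map A (p * q) = toric_map A p * toric_map A q"
proof -
  have 1: "toric_map A (Poly_Mapping.single m c * Poly_Mapping.single n d) =
      toric_map A (Poly_Mapping.single m c) * toric_map A (Poly_Mapping.single n d)" for m n c d
  proof -
    have "Poly_Mapping.single (0 :: int \<times> int) (c * d) =
        Poly_Mapping.single 0 c * Poly_Mapping.single 0 d"
      by (simp add: mult_single)
    then show ?thesis
      by (simp only: mult_single[of m] toric_map_single monom_image_add ac_simps)
  qed
  let ?t = "\<lambda>p m. Poly_Mapping.single m (Poly_Mapping.lookup p m)"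
  have "p * q = (\<Sum>m\<in>Poly_Mapping.keys p. \<Sum>n\<in>Poly_Mapping.keys q. ?t p m * ?t q n)"
    by (subst poly_as_sum[of p], subst poly_as_sum[of q]) (simp add: sum_product)
  then have "toric_map A (p * q) =
      (\<Sum>m\<in>Poly_Mapping.keys p. \<Sum>n\<in>Poly_Mapping.keys q. toric_map A (?t p m) * toric_map A (?t q n))"
    by (simp add: toric_map_sum 1)
  also have "\<dots> = toric_map A (\<Sum>m\<in>Poly_Mapping.keys p. ?t p m) *
      toric_map A (\<Sum>n\<in>Poly_Mapping.keys q. ?t q n)"
    by (simp add: toric_map_sum sum_product)
  finally show ?thesis
    by (simp flip: poly_as_sum)
qed

end

(*
  A binomial u - v of a toric ideal is forced, up to a scalar, into every binomial generating set
  as soon as u and v are coprime and are the only monomials of their degree.  These binomials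
  generate the ideal if every other coprime pair u, v of equal degree has a third monomial of that
  degree that shares a variable with u and one with v: then u - v splits into two binomials that
  are monomial multiples of binomials of smaller degree.

  Put a = 2k.  The monomials of a given degree correspond to the points (x, y, z) of a translate of
  the lattice spanned by (1, -2, 1) and (k + 1, 0, -k) that are nonnegative and whose exponent of t,
  an affine function of the point, is nonnegative.  If u, v are such points and r + r' = u + v with
  r, r' in the same translate, then one of r, r' has a nonnegative exponent of t, whatever the
  weights are.  This provides the third monomial except for a few short differences
  u - v, where it either follows from convexity in the same way or does not exist at all.
*)
theory Submission
  imports Defs
begin

section \<open>Ideals as linear spans\<close>

lemma module_mult: "module ((*) :: 'r::comm_ring_1 \<Rightarrow> 'r \<Rightarrow> 'r)"
  by unfold_locales (simp_all add: algebra_simps)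

lemmas ideal_gen_base = module.span_base[OF module_mult, folded ideal_gen_def]
  and ideal_gen_zero = module.span_zero[OF module_mult, folded ideal_gen_def]
  and ideal_gen_add = module.span_add[OF module_mult, folded ideal_gen_def]
  and ideal_gen_diff = module.span_diff[OF module_mult, folded ideal_gen_def]
  and ideal_gen_mult = module.span_scale[OF module_mult, folded ideal_gen_def]
  and ideal_gen_mono = module.span_mono[OF module_mult, folded ideal_gen_def]

lemma ideal_gen_minimal: "G \<subseteq> ideal_gen H \<Longrightarrow> ideal_gen G \<subseteq> ideal_gen H"
  unfolding ideal_gen_def
  by (rule module.span_minimal[OF module_mult _ module.subspace_span[OF module_mult]])

section \<open>The grading by degree and the binomials of a toric ideal\<close>

text \<open>The exponent vector of the Laurent monomial to which the toric map sends the monomial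
  \<open>m\<close>.\<close>

definition multidegree :: "('v \<Rightarrow> int \<times> int) \<Rightarrow> ('v \<Rightarrow>\<^sub>0 nat) \<Rightarrow> int \<times> int" where
  "multidegree A m = (\<Sum>v\<in>Poly_Mapping.keys m.
     (int (Poly_Mapping.lookup m v) * fst (A v), int (Poly_Mapping.lookup m v) * snd (A v)))"

definition monom_diff :: "('v \<Rightarrow>\<^sub>0 nat) \<Rightarrow> ('v \<Rightarrow>\<^sub>0 nat) \<Rightarrow> ('v, 'k::field) mpoly" where
  "monom_diff m n = Poly_Mapping.single m 1 - Poly_Mapping.single n 1"

lemma multidegree_superset:
  assumes "finite V" "Poly_Mapping.keys m \<subseteq> V"
  shows "multidegree A m = (\<Sum>v\<in>V.
     (int (Poly_Mapping.lookup m v) * fst (A v), int (Poly_Mapping.lookup m v) * snd (A v)))"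
  unfolding multidegree_def using assms
  by (intro sum.mono_neutral_left) (auto simp: in_keys_iff zero_prod_def)

lemma multidegree_add: "multidegree A (m + n) = multidegree A m + multidegree A n"
proof -
  let ?V = "Poly_Mapping.keys m \<union> Poly_Mapping.keys n"
  have "Poly_Mapping.keys (m + n) \<subseteq> ?V" by (rule keys_add)
  then show ?thesis
    by (simp add: multidegree_superset[of ?V] lookup_add sum.distrib[symmetric] algebra_simps)
qed

lemma multidegree_single: "multidegree A (Poly_Mapping.single v 1) = A v"
  by (simp add: multidegree_def)

lemma prod_single_one:
  "(\<Prod>i\<in>S. Poly_Mapping.single (f i) 1) = Poly_Mapping.single (\<Sum>i\<in>S. f i) (1 :: 'k::comm_semiring_1)"
  by (induction S rule: infinite_finite_induct) (auto simp: mult_single)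

lemma single_one_power:
  "Poly_Mapping.single (d :: int \<times> int) (1 :: 'k::field) ^ n =
     Poly_Mapping.single (int n * fst d, int n * snd d) 1"
proof (induction n)
  case 0
  show ?case by (simp flip: zero_prod_def)
next
  case (Suc n)
  then show ?case by (cases d) (simp add: mult_single algebra_simps)
qed

lemma toric_map_monom:
  "toric_map A (Poly_Mapping.single m c) = Poly_Mapping.single (multidegree A m) c"
  by (simp add: toric_map_single single_one_power prod_single_one multidegree_def mult_single)

lemma toric_map_diff: "toric_map A (p - q) = toric_map A p - toric_map A q"
proof -
  have "toric_map A (p - q) + toric_map A q = toric_map A p"
    by (simp flip: toric_map_add)
  then show ?thesis by (simp add: algebra_simps)
qed

lemma lookup_toric_map:
  "Poly_Mapping.lookup (toric_map A p) d =
     (\<Sum>m\<in>Poly_Mapping.keys p. if multidegree A m = d then Poly_Mapping.lookup p m else 0)"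
proof -
  have "toric_map A p = (\<Sum>m\<in>Poly_Mapping.keys p.
      Poly_Mapping.single (multidegree A m) (Poly_Mapping.lookup p m))"
    by (subst poly_as_sum[of p]) (simp add: toric_map_sum toric_map_monom)
  then show ?thesis
    by (simp add: lookup_sum lookup_single when_def)
qed

text \<open>The coefficient of the image of \<open>p\<close> at the degree of \<open>m\<close> sums
  the coefficients of all terms of \<open>p\<close> of that degree. A single term could not
  cancel.\<close>

lemma toric_ideal_degree_partner:
  assumes "p \<in> toric_ideal A" "m \<in> Poly_Mapping.keys p"
  obtains n where "n \<in> Poly_Mapping.keys p" "n \<noteq> m" "multidegree A n = multidegree A m"
proof -
  have "\<exists>n \<in> Poly_Mapping.keys p. n \<noteq> m \<and> multidegree A n = multidegree A m"
  proof (rule ccontr)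
    assume "\<not> ?thesis"
    then have "(\<Sum>n\<in>Poly_Mapping.keys p. if multidegree A n = multidegree A m then Poly_Mapping.lookup p n else 0)
        = (\<Sum>n\<in>{m}. Poly_Mapping.lookup p n)"
      using assms(2) by (intro sum.mono_neutral_cong_right) auto
    then have "Poly_Mapping.lookup (toric_map A p) (multidegree A m) = Poly_Mapping.lookup p m"
      by (simp add: lookup_toric_map)
    then show False
      using assms by (simp add: toric_ideal_def in_keys_iff)
  qed
  then show thesis using that by blast
qed

lemma toric_ideal_gen: "ideal_gen (toric_ideal A) = toric_ideal A"
proof -
  have "module.subspace (*) (toric_ideal A)"
    by (auto simp: module.subspace_def[OF module_mult] toric_ideal_def toric_map_mult toric_map_add)
       (simp add: toric_map_def)
  then show ?thesis
    by (simp add: ideal_gen_def module.span_eq_iff[OF module_mult])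
qed

lemma monom_diff_in_toric_ideal:
  "(monom_diff m n :: ('v, 'k::field) mpoly) \<in> toric_ideal A \<longleftrightarrow> multidegree A m = multidegree A n"
proof
  assume "(monom_diff m n :: ('v, 'k) mpoly) \<in> toric_ideal A"
  then have "Poly_Mapping.single (multidegree A m) (1::'k) = Poly_Mapping.single (multidegree A n) 1"
    by (simp add: monom_diff_def toric_ideal_def toric_map_diff toric_map_monom)
  then show "multidegree A m = multidegree A n"
    by (metis keys_single singleton_inject zero_neq_one)
qed (simp add: monom_diff_def toric_ideal_def toric_map_diff toric_map_monom)

lemma lookup_scaled_monom_diff:
  "Poly_Mapping.lookup (Poly_Mapping.single 0 c * monom_diff u v) m =
    (if m = u then c else 0) - (if m = v then c else 0)"
  by (auto simp: monom_diff_def right_diff_distrib mult_single lookup_minus lookup_single when_def)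

lemma keys_scaled_monom_diff:
  "u \<noteq> v \<Longrightarrow> c \<noteq> 0 \<Longrightarrow> Poly_Mapping.keys (Poly_Mapping.single 0 c * monom_diff u v) = {u, v}"
  by (auto simp: in_keys_iff lookup_scaled_monom_diff split: if_splits)

lemma keys_monom_diff:
  "u \<noteq> v \<Longrightarrow> Poly_Mapping.keys (monom_diff u v :: ('v, 'k::field) mpoly) = {u, v}"
  using keys_scaled_monom_diff[of u v "1::'k"] by simp

text \<open>A partner of \<open>u\<close> of the same degree exhausts the two-element support, and
  the two coefficients cancel in that degree.\<close>

lemma toric_ideal_binomial:
  assumes "p \<in> toric_ideal A" "is_binomial p" "u \<in> Poly_Mapping.keys p"
  obtains c v where "c \<noteq> 0" "u \<noteq> v" "multidegree A u = multidegree A v"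
    "p = Poly_Mapping.single 0 c * monom_diff u v"
proof -
  obtain v where v: "v \<in> Poly_Mapping.keys p" "v \<noteq> u" "multidegree A v = multidegree A u"
    using toric_ideal_degree_partner assms by metis
  have keys: "Poly_Mapping.keys p = {u, v}"
    using assms v by (intro card_subset_eq[symmetric]) (auto simp: is_binomial_def)
  let ?c = "Poly_Mapping.lookup p u"
  have "Poly_Mapping.lookup (toric_map A p) (multidegree A u) = 0"
    using assms by (simp add: toric_ideal_def)
  then have "?c + Poly_Mapping.lookup p v = 0"
    using v by (simp add: lookup_toric_map keys)
  then have "Poly_Mapping.lookup p v = - ?c"
    by (rule minus_unique[symmetric])
  moreover have "Poly_Mapping.lookup p m = 0" if "m \<notin> {u, v}" for m
    using that unfolding keys[symmetric] by (simp add: in_keys_iff)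
  ultimately have "p = Poly_Mapping.single 0 ?c * monom_diff u v"
    using v(2) by (intro poly_mapping_eqI) (simp add: lookup_scaled_monom_diff)
  then show thesis
    using that[of ?c v] assms(3) v(2,3) by (simp add: in_keys_iff)
qed

text \<open>Induction on the number of terms: subtracting a multiple of
  \<open>monom_diff m n\<close>, where \<open>n\<close> is another monomial of \<open>p\<close> of
  the degree of \<open>m\<close>, removes \<open>m\<close> and adds no new monomial.\<close>

lemma toric_ideal_subset_ideal_gen:
  assumes "\<And>m n. multidegree A m = multidegree A n \<Longrightarrow> monom_diff m n \<in> ideal_gen G"
  shows "toric_ideal A \<subseteq> ideal_gen (G :: ('v, 'k::field) mpoly set)"
proof
  fix p :: "('v, 'k) mpoly" assume "p \<in> toric_ideal A"
  then show "p \<in> ideal_gen G"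
  proof (induction "card (Poly_Mapping.keys p)" arbitrary: p rule: less_induct)
    case less
    show ?case
    proof (cases "p = 0")
      case True
      then show ?thesis by (simp add: ideal_gen_zero)
    next
      case False
      then obtain m where m: "m \<in> Poly_Mapping.keys p"
        by (metis all_not_in_conv keys_eq_empty)
      obtain n where n: "n \<in> Poly_Mapping.keys p" "n \<noteq> m" "multidegree A n = multidegree A m"
        using toric_ideal_degree_partner less.prems m by metis
      define b :: "('v, 'k) mpoly"
        where "b = Poly_Mapping.single 0 (Poly_Mapping.lookup p m) * monom_diff m n"
      have look: "Poly_Mapping.lookup (p - b) i =
          (if i = m then 0 else if i = n then Poly_Mapping.lookup p n + Poly_Mapping.lookup p m
           else Poly_Mapping.lookup p i)" for i
        using n by (auto simp: b_def lookup_minus lookup_scaled_monom_diff)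
      have "Poly_Mapping.keys (p - b) \<subset> Poly_Mapping.keys p"
        using m n by (auto simp: in_keys_iff look split: if_splits)
      moreover have "monom_diff m n \<in> (toric_ideal A :: ('v, 'k) mpoly set)"
        using n by (simp add: monom_diff_in_toric_ideal)
      then have "p - b \<in> toric_ideal A"
        using less.prems by (simp add: toric_ideal_def toric_map_diff toric_map_mult b_def)
      ultimately have "p - b \<in> ideal_gen G"
        using less.hyps by (simp add: psubset_card_mono)
      moreover have "b \<in> ideal_gen G"
        unfolding b_def using n by (intro ideal_gen_mult assms) auto
      ultimately show ?thesis
        using ideal_gen_add by fastforce
    qed
  qed
qed

section \<open>Indispensable binomials and unique presentation\<close>

text \<open>If \<open>u\<close> occurs in a multiple of some \<open>h\<close> in \<open>H\<close>,
  then \<open>u = s + m\<close> for a monomial \<open>m\<close> of \<open>h\<close>. The other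
  monomial \<open>n\<close> of \<open>h\<close> makes \<open>s + n\<close> a second monomial of this
  degree, so it is \<open>v\<close>. Coprimality forces \<open>s = 0\<close>, and \<open>h\<close>
  is a scalar multiple of \<open>u - v\<close>. Without such an \<open>h\<close> the coefficient of
  \<open>u\<close> vanishes on the whole ideal, yet it is 1 in \<open>u - v\<close>.\<close>

lemma binomial_indispensable:
  fixes H :: "('v, 'k::field) mpoly set"
  assumes H: "binomial_generating_set (toric_ideal A) H"
    and uv: "u \<noteq> v" "Poly_Mapping.keys u \<inter> Poly_Mapping.keys v = {}"
    and fiber: "{m. multidegree A m = multidegree A u} = {u, v}"
  shows "\<exists>c. c \<noteq> 0 \<and> Poly_Mapping.single 0 c * monom_diff u v \<in> H"
proof (rule ccontr)
  assume contra: "\<not> ?thesis"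
  have gen: "ideal_gen H = toric_ideal A" and bin: "\<And>h. h \<in> H \<Longrightarrow> is_binomial h"
    using H by (auto simp: binomial_generating_set_def)
  have *: "Poly_Mapping.lookup (f * h) u = 0" if h: "h \<in> H" for f h
  proof (rule ccontr)
    assume "Poly_Mapping.lookup (f * h) u \<noteq> 0"
    then have "u \<in> Poly_Mapping.keys (f * h)"
      by (simp add: in_keys_iff)
    then obtain s m where s: "u = s + m" "m \<in> Poly_Mapping.keys h"
      using keys_mult by blast
    have "h \<in> toric_ideal A"
      using h gen ideal_gen_base by blast
    then obtain c n where n: "c \<noteq> 0" "m \<noteq> n" "multidegree A m = multidegree A n"
        "h = Poly_Mapping.single 0 c * monom_diff m n"
      using toric_ideal_binomial bin[OF h] s by metis
    have "multidegree A (s + n) = multidegree A u"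
      by (simp add: s multidegree_add n)
    then have "s + n \<in> {u, v}"
      using fiber by blast
    then have "v = s + n"
      using s n by auto
    then have "Poly_Mapping.keys s \<subseteq> Poly_Mapping.keys u \<inter> Poly_Mapping.keys v"
      using s by (auto simp: in_keys_iff lookup_add)
    then have "s = 0"
      using uv by simp
    then show False
      using contra h n s \<open>v = s + n\<close> by auto
  qed
  have "monom_diff u v \<in> (toric_ideal A :: ('v, 'k) mpoly set)"
    using fiber by (auto simp: monom_diff_in_toric_ideal)
  then have "(monom_diff u v :: ('v, 'k) mpoly) \<in> module.span (*) H"
    using gen by (simp add: ideal_gen_def)
  then have "Poly_Mapping.lookup (monom_diff u v :: ('v, 'k) mpoly) u = 0"
    by (rule module.span_induct_alt[OF module_mult]) (auto simp: * lookup_add)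
  then show False
    using uv lookup_scaled_monom_diff[of "1::'k" u v u] by auto
qed

text \<open>Every binomial generating set contains \<open>G\<close> up to scalars, so no proper
  subset of \<open>G\<close> generates, and a minimal one consists of rescaled elements of
  \<open>G\<close> only.\<close>

lemma uniquely_presentedI:
  fixes I :: "('v, 'k::field) mpoly set"
  assumes I: "I = toric_ideal A" and gen: "binomial_generating_set I G"
    and indispensable: "\<And>g H. g \<in> G \<Longrightarrow> binomial_generating_set I H \<Longrightarrow>
          \<exists>c. c \<noteq> 0 \<and> Poly_Mapping.single 0 c * g \<in> H"
    and independent: "\<And>g c. g \<in> G \<Longrightarrow> c \<noteq> 0 \<Longrightarrow> Poly_Mapping.single 0 c * g \<in> G \<Longrightarrow>
          Poly_Mapping.single 0 c * g = g"
  shows "uniquely_presented I"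
  unfolding uniquely_presented_def
proof (intro exI[of _ G] conjI allI impI)
  show "minimal_binomial_generating_set I G"
    unfolding minimal_binomial_generating_set_def
  proof (intro conjI allI impI notI)
    fix H assume H: "H \<subset> G" "ideal_gen H = I"
    then have "binomial_generating_set I H"
      using gen by (auto simp: binomial_generating_set_def)
    \<comment> \<open>The multiple of \<open>g\<close> found in \<open>H\<close> lies in
      \<open>G\<close>, hence is \<open>g\<close> itself by \<open>independent\<close>.\<close>
    then have "g \<in> H" if "g \<in> G" for g
      using indispensable[OF that] independent[OF that] H by fastforce
    then show False using H by blast
  qed (rule gen)
next
  fix H assume "minimal_binomial_generating_set I H"
  then have H: "binomial_generating_set I H" and min: "\<And>H'. H' \<subset> H \<Longrightarrow> ideal_gen H' \<noteq> I"
    by (auto simp: minimal_binomial_generating_set_def)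
  \<comment> \<open>The rescaled elements of \<open>G\<close> in \<open>H\<close> already generate
    the ideal, so minimality makes them all of \<open>H\<close>.\<close>
  let ?H = "{h \<in> H. \<exists>g\<in>G. \<exists>c. c \<noteq> 0 \<and> h = Poly_Mapping.single 0 c * g}"
  have "G \<subseteq> ideal_gen ?H"
  proof
    fix g assume g: "g \<in> G"
    then obtain c where c: "c \<noteq> 0" "Poly_Mapping.single 0 c * g \<in> H"
      using indispensable[OF g H] by blast
    then have "Poly_Mapping.single 0 (inverse c) * (Poly_Mapping.single 0 c * g) \<in> ideal_gen ?H"
      using g by (intro ideal_gen_mult ideal_gen_base) blast
    then show "g \<in> ideal_gen ?H"
      using c by (simp add: mult.assoc[symmetric] mult_single)
  qed
  then have "I \<subseteq> ideal_gen ?H"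
    using gen ideal_gen_minimal unfolding binomial_generating_set_def by blast
  moreover have "ideal_gen ?H \<subseteq> ideal_gen H"
    by (rule ideal_gen_mono) auto
  ultimately have "ideal_gen ?H = I"
    using H by (auto simp: binomial_generating_set_def)
  then have eq: "H = ?H"
    using min[of ?H] by blast
  show "scalar_multiples H = scalar_multiples G"
  proof
    show "scalar_multiples H \<subseteq> scalar_multiples G"
    proof
      fix p assume "p \<in> scalar_multiples H"
      then obtain c h where "c \<noteq> 0" "h \<in> H" "p = Poly_Mapping.single 0 c * h"
        by (auto simp: scalar_multiples_def)
      moreover from this obtain d g where "d \<noteq> 0" "g \<in> G" "h = Poly_Mapping.single 0 d * g"
        using eq by blast
      ultimately have "c \<noteq> 0" "d \<noteq> 0" "g \<in> G"
          "p = Poly_Mapping.single 0 c * (Poly_Mapping.single 0 d * g)"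
        by simp_all
      then have "p = Poly_Mapping.single 0 (c * d) * g" "c * d \<noteq> 0" "g \<in> G"
        by (simp_all add: mult.assoc[symmetric] mult_single)
      then show "p \<in> scalar_multiples G"
        unfolding scalar_multiples_def by blast
    qed
    show "scalar_multiples G \<subseteq> scalar_multiples H"
    proof
      fix p assume "p \<in> scalar_multiples G"
      then obtain c g where g: "c \<noteq> 0" "g \<in> G" "p = Poly_Mapping.single 0 c * g"
        by (auto simp: scalar_multiples_def)
      obtain d where d: "d \<noteq> 0" "Poly_Mapping.single 0 d * g \<in> H"
        using indispensable[OF g(2) H] by blast
      then have "p = Poly_Mapping.single 0 (c / d) * (Poly_Mapping.single 0 d * g)" "c / d \<noteq> 0"
        using g by (simp_all add: mult.assoc[symmetric] mult_single)
      then show "p \<in> scalar_multiples H"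
        using d unfolding scalar_multiples_def by blast
    qed
  qed
qed

section \<open>Generation by induction on the degree\<close>

text \<open>A variable common to both monomials is cancelled and multiplied back after induction. A
  third monomial \<open>r\<close> splits \<open>u - v\<close> into \<open>u - r\<close> and
  \<open>r - v\<close>, to which this applies.\<close>

lemma monom_diff_in_ideal_genI:
  fixes G :: "('v, 'k::field) mpoly set"
  assumes pos: "\<And>v. 0 < fst (A v) + snd (A v)"
    and fibers: "\<And>u v. u \<noteq> v \<Longrightarrow> multidegree A u = multidegree A v \<Longrightarrow>
          Poly_Mapping.keys u \<inter> Poly_Mapping.keys v = {} \<Longrightarrow>
          monom_diff u v \<in> ideal_gen G \<or>
          (\<exists>r. multidegree A r = multidegree A u \<and> Poly_Mapping.keys u \<inter> Poly_Mapping.keys r \<noteq> {} \<and>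
               Poly_Mapping.keys r \<inter> Poly_Mapping.keys v \<noteq> {})"
    and "multidegree A u = multidegree A v"
  shows "monom_diff u v \<in> ideal_gen G"
proof -
  \<comment> \<open>By \<open>pos\<close>, this measure drops whenever a variable is
    cancelled.\<close>
  define size where "size m = nat (fst (multidegree A m) + snd (multidegree A m))" for m
  have nonneg: "0 \<le> fst (multidegree A m) + snd (multidegree A m)" for m
  proof -
    have "fst (multidegree A m) + snd (multidegree A m) =
        (\<Sum>v\<in>Poly_Mapping.keys m. int (Poly_Mapping.lookup m v) * (fst (A v) + snd (A v)))"
      by (simp add: multidegree_def fst_sum snd_sum sum.distrib distrib_left)
    also have "\<dots> \<ge> 0"
      by (intro sum_nonneg mult_nonneg_nonneg of_nat_0_le_iff less_imp_le pos)
    finally show ?thesis .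
  qed
  show ?thesis
    using assms(3)
  proof (induction "size u" arbitrary: u v rule: less_induct)
    case less
    have common: "monom_diff m n \<in> ideal_gen G"
      if mn: "multidegree A m = multidegree A n" "size m = size u"
        "Poly_Mapping.keys m \<inter> Poly_Mapping.keys n \<noteq> {}" for m n
    proof -
      obtain x where x: "x \<in> Poly_Mapping.keys m" "x \<in> Poly_Mapping.keys n"
        using mn by blast
      let ?x = "Poly_Mapping.single x (1::nat)"
      have split: "p = ?x + (p - ?x)" if "x \<in> Poly_Mapping.keys p" for p
        using that
        by (intro poly_mapping_eqI) (auto simp: lookup_add lookup_minus lookup_single when_def in_keys_iff)
      have deg: "multidegree A p = A x + multidegree A (p - ?x)" if "x \<in> Poly_Mapping.keys p" for p
        using split[OF that] multidegree_add multidegree_single by metis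
      have "monom_diff (m - ?x) (n - ?x) \<in> ideal_gen G"
      proof (rule less.hyps)
        show "multidegree A (m - ?x) = multidegree A (n - ?x)"
          using deg[OF x(1)] deg[OF x(2)] mn by simp
        have "size (m - ?x) < size m"
          using deg[OF x(1)] pos[of x] nonneg[of "m - ?x"] by (simp add: size_def)
        then show "size (m - ?x) < size u"
          using mn by simp
      qed
      then have "Poly_Mapping.single ?x 1 * monom_diff (m - ?x) (n - ?x) \<in> ideal_gen G"
        by (rule ideal_gen_mult)
      then show ?thesis
        using split[OF x(1)] split[OF x(2)]
        by (simp add: monom_diff_def right_diff_distrib mult_single)
    qed
    consider "u = v" | "Poly_Mapping.keys u \<inter> Poly_Mapping.keys v \<noteq> {}"
      | "monom_diff u v \<in> ideal_gen G"
      | r where "multidegree A r = multidegree A u" "Poly_Mapping.keys u \<inter> Poly_Mapping.keys r \<noteq> {}"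
         "Poly_Mapping.keys r \<inter> Poly_Mapping.keys v \<noteq> {}"
      using fibers[OF _ less.prems] by blast
    then show ?case
    proof cases
      case 1
      then show ?thesis by (simp add: monom_diff_def ideal_gen_zero)
    next
      case 4
      then have "monom_diff u r + monom_diff r v \<in> ideal_gen G"
        using less.prems by (intro ideal_gen_add common) (auto simp: size_def)
      then show ?thesis by (simp add: monom_diff_def)
    qed (use common less.prems in auto)
  qed
qed

text \<open>The generating set takes one binomial from each degree whose monomials are just a
  coprime pair; all of these are indispensable.\<close>

lemma uniquely_presented_toric_ideal:
  assumes pos: "\<And>v. 0 < fst (A v) + snd (A v)"
    and fibers: "\<And>u v. u \<noteq> v \<Longrightarrow> multidegree A u = multidegree A v \<Longrightarrow>
          Poly_Mapping.keys u \<inter> Poly_Mapping.keys v = {} \<Longrightarrow>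
          {m. multidegree A m = multidegree A u} = {u, v} \<or>
          (\<exists>r. multidegree A r = multidegree A u \<and> Poly_Mapping.keys u \<inter> Poly_Mapping.keys r \<noteq> {} \<and>
               Poly_Mapping.keys r \<inter> Poly_Mapping.keys v \<noteq> {})"
  shows "uniquely_presented (toric_ideal A :: ('v, 'k::field) mpoly set)"
proof -
  define P where "P d uv \<longleftrightarrow> (case uv of (u, v) \<Rightarrow> u \<noteq> v \<and>
      Poly_Mapping.keys u \<inter> Poly_Mapping.keys v = {} \<and> {m. multidegree A m = d} = {u, v})" for d uv
  \<comment> \<open>Both orders of a pair satisfy \<open>P d\<close>; the choice keeps one of
    \<open>u - v\<close> and \<open>v - u\<close>.\<close>
  define c where "c d = (SOME uv. P d uv)" for d
  define G :: "('v, 'k) mpoly set"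
    where "G = {monom_diff (fst (c d)) (snd (c d)) | d. \<exists>uv. P d uv}"
  have G: "\<exists>d u v. g = monom_diff u v \<and> c d = (u, v) \<and> P d (u, v)" if g: "g \<in> G" for g
  proof -
    obtain d uv where "g = monom_diff (fst (c d)) (snd (c d))" "P d uv"
      using g unfolding G_def by blast
    then show ?thesis
      using someI[of "P d" uv] unfolding c_def by (metis prod.collapse)
  qed
  have GI: "monom_diff u v \<in> ideal_gen G" if uv: "P d (u, v)" for d u v
  proof -
    obtain u' v' where c: "c d = (u', v')" by fastforce
    then have "P d (u', v')"
      using someI[of "P d", OF uv] by (simp add: c_def)
    then have "{u', v'} = {u, v}"
      using uv by (simp add: P_def)
    then have "(u' = u \<and> v' = v) \<or> (u' = v \<and> v' = u)"
      by (simp add: doubleton_eq_iff)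
    moreover have "monom_diff (fst (c d)) (snd (c d)) \<in> G"
      using uv unfolding G_def by blast
    then have "monom_diff u' v' \<in> ideal_gen G"
      unfolding c by (simp add: ideal_gen_base)
    \<comment> \<open>If the chosen order is the reverse one, \<open>u - v\<close> is the negative
      of the generator.\<close>
    ultimately show ?thesis
      using ideal_gen_diff[OF ideal_gen_zero, of "monom_diff u' v'" G] by (auto simp: monom_diff_def)
  qed
  show ?thesis
  proof (rule uniquely_presentedI[OF refl, where G = G])
    have "toric_ideal A \<subseteq> ideal_gen G"
    proof (rule toric_ideal_subset_ideal_gen, rule monom_diff_in_ideal_genI[OF pos])
      fix u v
      assume uv: "u \<noteq> v" "multidegree A u = multidegree A v"
        "Poly_Mapping.keys u \<inter> Poly_Mapping.keys v = {}"
      show "monom_diff u v \<in> ideal_gen G \<or>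
          (\<exists>r. multidegree A r = multidegree A u \<and> Poly_Mapping.keys u \<inter> Poly_Mapping.keys r \<noteq> {} \<and>
               Poly_Mapping.keys r \<inter> Poly_Mapping.keys v \<noteq> {})"
        using fibers[OF uv] GI[of "multidegree A u" u v] uv by (auto simp: P_def)
    qed auto
    moreover have "g \<in> toric_ideal A" if g0: "g \<in> G" for g
    proof -
      obtain d u v where g: "g = monom_diff u v" "P d (u, v)" using G[OF g0] by blast
      then have "{u, v} \<subseteq> {m. multidegree A m = d}" by (simp add: P_def)
      then show ?thesis using g by (simp add: monom_diff_in_toric_ideal)
    qed
    then have "G \<subseteq> toric_ideal A" by blast
    then have "ideal_gen G \<subseteq> toric_ideal A"
      using ideal_gen_minimal toric_ideal_gen by metis
    moreover have "is_binomial g" if "g \<in> G" for g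
      using G[OF that] by (auto simp: is_binomial_def P_def keys_monom_diff)
    ultimately show "binomial_generating_set (toric_ideal A) G"
      by (auto simp: binomial_generating_set_def)
  next
    fix g and H :: "('v, 'k) mpoly set"
    assume g: "g \<in> G" and H: "binomial_generating_set (toric_ideal A) H"
    obtain d u v where "g = monom_diff u v" "P d (u, v)" using G[OF g] by blast
    moreover from this have "multidegree A u = d" by (auto simp: P_def)
    ultimately show "\<exists>c. c \<noteq> 0 \<and> Poly_Mapping.single 0 c * g \<in> H"
      using binomial_indispensable[OF H, of u v] by (auto simp: P_def)
  next
    fix g e assume g: "g \<in> G" "Poly_Mapping.single 0 e * g \<in> G" "e \<noteq> 0"
    obtain d u v where 1: "g = monom_diff u v" "c d = (u, v)" "P d (u, v)" using G[OF g(1)] by blast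
    obtain d' u' v' where 2: "Poly_Mapping.single 0 e * g = monom_diff u' v'"
      "c d' = (u', v')" "P d' (u', v')" using G[OF g(2)] by blast
    have "Poly_Mapping.keys (Poly_Mapping.single 0 e * g) = {u, v}"
      unfolding 1(1) using 1(3) g(3) by (simp add: keys_scaled_monom_diff P_def)
    moreover have "Poly_Mapping.keys (Poly_Mapping.single 0 e * g) = {u', v'}"
      unfolding 2(1) using 2(3) by (simp add: keys_monom_diff P_def)
    \<comment> \<open>Proportional elements have the same support, hence the same degree, and
      \<open>G\<close> has at most one element per degree.\<close>
    ultimately have "{m. multidegree A m = d} = {m. multidegree A m = d'}" "u \<in> {m. multidegree A m = d}"
      using 1(3) 2(3) by (simp_all add: P_def)
    then have "d = d'"
      by auto
    then show "Poly_Mapping.single 0 e * g = g"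
      using 1 2 by simp
  qed
qed

section \<open>Lattice points of a fiber\<close>

lemma int_mult_le_minus: "0 < c \<Longrightarrow> l \<le> -1 \<Longrightarrow> c * l \<le> - c" for c l :: int
  using mult_left_mono[of l "-1" c] by simp

text \<open>
  A point \<open>(x, y, z)\<close> of the fiber stands for the monomial of degree \<open>(N, S)\<close> with these exponents
  whose exponent of \<open>t\<close> is the slack \<open>S - (w1 * x + w2 * y + w3 * z)\<close>.
\<close>

locale weighted_fiber =
  fixes k w1 w2 w3 N S :: int
  assumes k: "2 \<le> k"
begin

definition in_fiber :: "int \<Rightarrow> int \<Rightarrow> int \<Rightarrow> bool" where
  "in_fiber x y z \<longleftrightarrow> 0 \<le> x \<and> 0 \<le> y \<and> 0 \<le> z \<and>
     2 * k * x + (2 * k + 1) * y + (2 * k + 2) * z = N \<and> w1 * x + w2 * y + w3 * z \<le> S"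

text \<open>A common factor \<open>t\<close> is left out, so \<open>share\<close> implies a common
  variable of the monomials but not conversely. Coprime monomials never
  \<open>share\<close>.\<close>

definition share :: "int \<times> int \<times> int \<Rightarrow> int \<times> int \<times> int \<Rightarrow> bool" where
  "share = (\<lambda>(x, y, z) (x', y', z'). 0 < x \<and> 0 < x' \<or> 0 < y \<and> 0 < y' \<or> 0 < z \<and> 0 < z')"

definition linked :: "int \<times> int \<times> int \<Rightarrow> int \<times> int \<times> int \<Rightarrow> bool" where
  "linked u v \<longleftrightarrow> (\<exists>x y z. in_fiber x y z \<and> share u (x, y, z) \<and> share (x, y, z) v)"

lemma share_commute: "share u v \<longleftrightarrow> share v u"
  by (auto simp: share_def)

lemma linked_commute: "linked u v \<longleftrightarrow> linked v u"
  unfolding linked_def using share_commute by blast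

lemma linkedI: "in_fiber x y z \<Longrightarrow> share u (x, y, z) \<Longrightarrow> share (x, y, z) v \<Longrightarrow> linked u v"
  unfolding linked_def by blast

text \<open>The vectors \<open>(1, -2, 1)\<close> and \<open>(k + 1, 0, -k)\<close> form a basis of
  the differences: the degree equation makes \<open>dy\<close> even, which fixes \<open>m\<close>,
  and the rest fixes \<open>l\<close>.\<close>

lemma lattice_coordinates:
  assumes "in_fiber x y z" "in_fiber x' y' z'"
  obtains m l where "x = x' + (k + 1) * l + m" "y = y' - 2 * m" "z = z' + m - k * l"
proof -
  define dx dy dz where d: "dx = x - x'" "dy = y - y'" "dz = z - z'"
  have eq: "2 * k * dx + (2 * k + 1) * dy + (2 * k + 2) * dz = 0"
    using assms by (simp add: in_fiber_def d algebra_simps)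
  then have "dy = 2 * (- (k * dx + k * dy + (k + 1) * dz))"
    by (simp add: algebra_simps)
  then obtain m where m: "dy = - 2 * m" by (metis minus_mult_commute mult_minus_right)
  \<comment> \<open>The sum of the outer coordinates is 2 on \<open>(1, -2, 1)\<close> and 1 on
    \<open>(k + 1, 0, -k)\<close>, so \<open>e\<close> is the coordinate along the latter.\<close>
  define e where "e = dx + dz - 2 * m"
  have "2 * (k * e + (dz - m)) = 0"
    using eq unfolding m e_def by (simp add: algebra_simps)
  then have z: "dz = m - k * e" by simp
  then have x: "dx = (k + 1) * e + m" by (simp add: e_def algebra_simps)
  show thesis
    by (rule that[of e m]) (use x m z d in auto)
qed

text \<open>The slacks of the two candidates add up to those of the given points, so one is nonnegative.\<close>

lemma linked_split:
  assumes "in_fiber x1 y1 z1" "in_fiber x2 y2 z2" "0 \<le> x" "0 \<le> y" "0 \<le> z" "0 \<le> x'" "0 \<le> y'" "0 \<le> z'"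
    and sum: "x + x' = x1 + x2" "y + y' = y1 + y2" "z + z' = z1 + z2"
    and deg: "2 * k * x + (2 * k + 1) * y + (2 * k + 2) * z = N"
    and "share (x1, y1, z1) (x, y, z)" "share (x, y, z) (x2, y2, z2)"
    and "share (x1, y1, z1) (x', y', z')" "share (x', y', z') (x2, y2, z2)"
  shows "linked (x1, y1, z1) (x2, y2, z2)"
proof -
  have x': "x' = x1 + x2 - x" "y' = y1 + y2 - y" "z' = z1 + z2 - z"
    using sum by auto
  have "2 * k * x' + (2 * k + 1) * y' + (2 * k + 2) * z' = N"
    using assms(1,2) deg unfolding x' by (simp add: in_fiber_def algebra_simps)
  moreover have "(w1 * x + w2 * y + w3 * z) + (w1 * x' + w2 * y' + w3 * z') \<le> S + S"
    using assms(1,2) unfolding x' by (simp add: in_fiber_def algebra_simps)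
  ultimately have "in_fiber x y z \<or> in_fiber x' y' z'"
    using assms unfolding in_fiber_def by linarith
  then show ?thesis
    using assms linkedI by blast
qed

text \<open>For \<open>m \<ge> 2\<close> a step along \<open>(1, -2, 1)\<close> from each end splits
  the sum of the two points. For \<open>m = 1\<close> the points are \<open>(0, 2, 0)\<close> and
  \<open>(1, 0, 1)\<close>, and the fiber has no others.\<close>

lemma fiber_y_xz:
  assumes u: "in_fiber 0 y 0" and v: "in_fiber x 0 z" and pos: "0 < x" "0 < z"
    and r: "in_fiber p b c"
  shows "linked (0, y, 0) (x, 0, z) \<or> (p, b, c) = (0, y, 0) \<or> (p, b, c) = (x, 0, z)"
proof -
  obtain m l where ml: "x = 0 + (k + 1) * l + m" "0 = y - 2 * m" "z = 0 + m - k * l"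
    using lattice_coordinates[OF v u] .
  consider "m \<ge> 2" | "m = 1" | "m \<le> 0" by linarith
  then show ?thesis
  proof cases
    case 1
    have xz: "2 < x + z"
    proof (rule ccontr)
      assume "\<not> ?thesis"
      then have "x = 1" "z = 1" using pos by auto
      then have "(2 * k + 1) * y = (2 * k + 1) * 2"
        using u v by (simp add: in_fiber_def)
      then have "y = 2" using k by (simp only: mult_cancel_left) auto
      then show False using 1 ml by simp
    qed
    \<comment> \<open>The candidates are \<open>(x, 0, z) - (1, -2, 1)\<close> and
      \<open>(0, y, 0) + (1, -2, 1)\<close>; by \<open>xz\<close> the first still contains
      \<open>x\<close> or \<open>z\<close>.\<close>
    show ?thesis
      by (rule disjI1, rule linked_split[OF u v, of "x - 1" 2 "z - 1" 1 "y - 2" 1])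
         (use pos ml 1 xz v in \<open>auto simp: share_def in_fiber_def algebra_simps\<close>)
  next
    case 2
    \<comment> \<open>A positive \<open>l\<close> lowers \<open>z\<close> by at least
      \<open>k\<close>, a negative one lowers \<open>x\<close> by at least \<open>k + 1\<close>;
      \<open>m = 1\<close> cannot make up for either.\<close>
    have "l = 0"
    proof (rule ccontr)
      assume "l \<noteq> 0"
      then consider "l \<ge> 1" | "l \<le> -1" by linarith
      then show False
      proof cases
        case 1
        then have "k \<le> k * l" using k by simp
        then show False using 2 ml pos k by linarith
      next
        case 2
        then have "(k + 1) * l \<le> - (k + 1)" using k by (intro int_mult_le_minus) auto
        then show False using \<open>m = 1\<close> ml pos k by linarith
      qed
    qed
    then have [simp]: "x = 1" "y = 2" "z = 1" using ml 2 by auto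
    obtain m' l' where "p = 0 + (k + 1) * l' + m'" "b = y - 2 * m'" "c = 0 + m' - k * l'"
      using lattice_coordinates[OF r u] .
    then have ml': "p = (k + 1) * l' + m'" "b = 2 - 2 * m'" "c = m' - k * l'"
      by simp_all
    have nonneg: "0 \<le> p" "0 \<le> b" "0 \<le> c" using r by (auto simp: in_fiber_def)
    have "m' \<le> 1" using ml' nonneg by simp
    have "l' = 0"
    proof (rule ccontr)
      assume "l' \<noteq> 0"
      then consider "l' \<ge> 1" | "l' \<le> -1" by linarith
      then show False
      proof cases
        case 1
        then have "k \<le> k * l'" using k by simp
        then show False using \<open>m' \<le> 1\<close> ml' nonneg k by linarith
      next
        case 2
        then have "(k + 1) * l' \<le> - (k + 1)" using k by (intro int_mult_le_minus) auto
        then show False using \<open>m' \<le> 1\<close> ml' nonneg k by linarith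
      qed
    qed
    then have "m' = 0 \<or> m' = 1" using ml' nonneg \<open>m' \<le> 1\<close> by auto
    then show ?thesis using ml' \<open>l' = 0\<close> by auto
  next
    case 3
    then have "m = 0" "y = 0" using ml u by (auto simp: in_fiber_def)
    then have "2 * k * x + (2 * k + 2) * z = 0"
      using u v \<open>y = 0\<close> unfolding in_fiber_def by simp
    moreover have "0 < 2 * k * x" "0 < (2 * k + 2) * z" using k pos by auto
    ultimately have False by linarith
    then show ?thesis ..
  qed
qed

text \<open>For \<open>l \<ge> 2\<close> a shift by \<open>(k + 1, 0, -k)\<close>, corrected along
  \<open>(1, -2, 1)\<close> if necessary, splits the sum. For \<open>l = 1\<close> every third point
  links the pair directly, except \<open>(k, 0, k)\<close> when \<open>m = k\<close>, where
  convexity helps.\<close>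

lemma fiber_x_yz:
  assumes u: "in_fiber x 0 0" and v: "in_fiber 0 y z" and pos: "0 < x"
    and r: "in_fiber p b c"
  shows "linked (x, 0, 0) (0, y, z) \<or> (p, b, c) = (x, 0, 0) \<or> (p, b, c) = (0, y, z)"
proof -
  obtain m l where "x = 0 + (k + 1) * l + m" "0 = y - 2 * m" "0 = z + m - k * l"
    using lattice_coordinates[OF u v] .
  then have ml: "x = (k + 1) * l + m" "y = 2 * m" "z = k * l - m"
    by linarith+
  have nonneg: "0 \<le> y" "0 \<le> z" "0 \<le> p" "0 \<le> b" "0 \<le> c" using v r by (auto simp: in_fiber_def)
  then have m: "0 \<le> m" "m \<le> k * l" using ml by auto
  have "0 \<le> k * l" using m by simp
  then have "0 \<le> l" using k by (simp add: zero_le_mult_iff)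
  moreover have "l \<noteq> 0" using m ml pos by auto
  ultimately consider "l = 1" | "1 \<le> l - 1" by linarith
  then show ?thesis
  proof cases
    case 2
    define L e where "L = l - 1" and "e = k * (l - 1)"
    have "k * 1 \<le> k * (l - 1)" using 2 k by (intro mult_left_mono) auto
    then have e: "1 \<le> L" "k \<le> e" "x = e + L + k + 1 + m" "z = e + k - m"
      using 2 ml by (simp_all add: L_def e_def algebra_simps)
    have N: "N = 2 * k * (e + L + k + 1 + m)"
      using u e by (simp add: in_fiber_def)
    show ?thesis
    proof (cases "m \<le> e")
      case True
      \<comment> \<open>The candidates are \<open>(x, 0, 0) - (k + 1, 0, -k)\<close> and
        \<open>(0, y, z) + (k + 1, 0, -k)\<close>.\<close>
      show ?thesis
        by (intro disjI1 linked_split[OF u v, of "e + L + m" 0 k "k + 1" y "e - m"])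
           (use True e m ml N k in \<open>auto simp: share_def algebra_simps\<close>)
    next
      case False
      \<comment> \<open>The point \<open>(0, y, z) + (k + 1, 0, -k)\<close> has third coordinate
        \<open>-n\<close> here; \<open>n\<close> steps of \<open>(1, -2, 1)\<close> bring it to
        0.\<close>
      define n where "n = m - e"
      have n: "m = e + n" "0 < n" "n \<le> k"
        using False e nonneg by (auto simp: n_def)
      show ?thesis
        by (intro disjI1 linked_split[OF u v, of "e + L + e" "2 * n" "k - n" "k + 1 + n" "2 * e" 0])
           (use n e ml(2) N k in \<open>auto simp: share_def algebra_simps\<close>)
    qed
  next
    case 1
    then have x: "x = k + 1 + m" "z = k - m" "m \<le> k" using ml m by auto
    obtain m' l' where "p = 0 + (k + 1) * l' + m'" "b = y - 2 * m'" "c = z + m' - k * l'"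
      using lattice_coordinates[OF r v] .
    then have r_eq: "p = (k + 1) * l' + m'" "b = 2 * m - 2 * m'" "c = k - m + m' - k * l'"
      using ml x by auto
    have l'_pos: "0 < l'" if "0 < p" "m' \<le> 0"
    proof (rule ccontr)
      assume "\<not> 0 < l'"
      then have "(k + 1) * l' \<le> (k + 1) * 0" using k by (intro mult_left_mono) auto
      then show False using that r_eq by simp
    qed
    have l'_le: "l' \<le> n" if "k * l' < k * (n + 1)" for n
      using that k by (simp add: mult_less_cancel_left)
    show ?thesis
    proof (cases "share (x, 0, 0) (p, b, c) \<and> share (p, b, c) (0, y, z)")
      case True
      then show ?thesis using linkedI r by blast
    next
      case False
      \<comment> \<open>Sharing with \<open>(x, 0, 0)\<close> means \<open>0 < p\<close>;
        \<open>y = 2 * m\<close> and \<open>z = k - m\<close> vanish exactly at \<open>m = 0\<close>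
        and \<open>m = k\<close>.\<close>
      then have "p = 0 \<or> (b = 0 \<or> m = 0) \<and> (c = 0 \<or> m = k)"
        using pos nonneg ml(2) x(2,3) m(1) by (auto simp: share_def)
      then consider "p = 0" | "0 < p" "b = 0" "c = 0" | "0 < p" "m = 0" "c = 0"
        | "0 < p" "m = k" "b = 0"
        using nonneg(3) k by force
      then show ?thesis
      proof cases
        case 1
        have "l' = 0"
        proof (rule ccontr)
          assume "l' \<noteq> 0"
          then consider "l' \<ge> 1" | "l' \<le> -1" by linarith
          then show False
          proof cases
            case 1
            then have "k \<le> k * l'" "k + 1 \<le> (k + 1) * l'" using k by simp_all
            then show False using \<open>p = 0\<close> r_eq nonneg m k by linarith
          next
            case 2
            then have "(k + 1) * l' \<le> - (k + 1)" using k by (intro int_mult_le_minus) auto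
            then show False using \<open>p = 0\<close> r_eq nonneg x m k by linarith
          qed
        qed
        then show ?thesis using 1 r_eq ml x by simp
      next
        case 2
        then have "m' = m" "k * l' = k * 1" using r_eq by auto
        then have "l' = 1" using k by (simp only: mult_cancel_left) auto
        then show ?thesis using 2 r_eq x \<open>m' = m\<close> by simp
      next
        case 3
        then have *: "k * l' = k + m'" "m' \<le> 0" using r_eq nonneg by auto
        then have "l' \<le> 1" using k by (intro l'_le) simp
        then have "l' = 1" using l'_pos 3 * by simp
        then show ?thesis using * 3 r_eq x by simp
      next
        case 4
        then have m': "m' = k" "k * l' \<le> k" using r_eq nonneg by auto
        then have "l' \<le> 1" using k by (intro l'_le) simp
        moreover have "0 \<le> l'"
        proof (rule ccontr)
          assume "\<not> 0 \<le> l'"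
          then have "(k + 1) * l' \<le> - (k + 1)" using k by (intro int_mult_le_minus) auto
          then show False using m' 4 r_eq by linarith
        qed
        ultimately consider "l' = 1" | "l' = 0" by linarith
        then show ?thesis
        proof cases
          case 1
          then show ?thesis using m' 4 r_eq x by simp
        next
          case 2
          then have [simp]: "p = k" "b = 0" "c = k" "y = 2 * k" "z = 0"
            using m' 4 r_eq ml x by auto
          \<comment> \<open>\<open>(1, 2k - 2, 1)\<close> lies on the segment from \<open>(0, 2k, 0)\<close> to \<open>(k, 0, k)\<close>\<close>
          have "(k - 1) * (w2 * (2 * k)) \<le> (k - 1) * S"
            using v k by (intro mult_left_mono) (auto simp: in_fiber_def)
          moreover have "w1 * k + w3 * k \<le> S" using r by (simp add: in_fiber_def)
          ultimately have "k * (w1 + w2 * (2 * k - 2) + w3) \<le> k * S"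
            by (simp add: algebra_simps)
          then have "w1 + w2 * (2 * k - 2) + w3 \<le> S"
            using k by simp
          then have "in_fiber 1 (2 * k - 2) 1"
            using v k by (simp add: in_fiber_def algebra_simps)
          then show ?thesis
            by (intro disjI1, elim linkedI) (use k pos in \<open>auto simp: share_def\<close>)
        qed
      qed
    qed
  qed
qed

text \<open>For \<open>l \<ge> 2\<close> the sum splits by the same kind of shift. For
  \<open>l = 1\<close> a third point has \<open>l' \<le> 2\<close>; if it does not share a variable
  with both ends, convexity still yields a link.\<close>

lemma fiber_xy_z:
  assumes u: "in_fiber x y 0" and v: "in_fiber 0 0 z" and pos: "0 < y"
    and r: "in_fiber p b c"
  shows "linked (x, y, 0) (0, 0, z) \<or> (p, b, c) = (x, y, 0) \<or> (p, b, c) = (0, 0, z)"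
proof -
  obtain m l where "x = 0 + (k + 1) * l + m" "y = 0 - 2 * m" "0 = z + m - k * l"
    using lattice_coordinates[OF u v] .
  moreover define n where "n = - m"
  ultimately have ml: "x = (k + 1) * l - n" "y = 2 * n" "z = k * l + n"
    by auto
  have nonneg: "0 \<le> x" "0 \<le> z" "0 \<le> p" "0 \<le> b" "0 \<le> c"
    using u v r by (auto simp: in_fiber_def)
  have n: "0 < n" using pos ml by simp
  then have "0 < (k + 1) * l" using nonneg ml by linarith
  then have "0 < l" using k by (simp add: zero_less_mult_iff)
  then consider "l = 1" | "1 \<le> l - 1" by linarith
  then show ?thesis
  proof cases
    case 2
    define L e where "L = l - 1" and "e = k * (l - 1)"
    have "k * 1 \<le> k * (l - 1)" using 2 k by (intro mult_left_mono) auto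
    then have e: "1 \<le> L" "k \<le> e" "x = e + L + k + 1 - n" "z = e + k + n"
      using 2 ml by (simp_all add: L_def e_def algebra_simps)
    have N: "N = (2 * k + 2) * (e + k + n)"
      using v e by (simp add: in_fiber_def)
    have kL: "k * L = e" by (simp add: L_def e_def)
    show ?thesis
    proof (cases "n \<le> e + L")
      case True
      have "2 * k * (e + L - n) + (2 * k + 1) * y + (2 * k + 2) * k = N"
        using kL[symmetric] unfolding N ml(2) by (simp add: algebra_simps)
      then show ?thesis
        by (intro disjI1 linked_split[OF u v, of "e + L - n" y k "k + 1" 0 "e + n"])
           (use True e ml(2) k n in \<open>auto simp: share_def\<close>)
    next
      case False
      \<comment> \<open>The point \<open>(x, y, 0) - (k + 1, 0, -k)\<close> has first coordinate
        \<open>-n1\<close> here; \<open>n1\<close> steps of \<open>(1, -2, 1)\<close> bring it to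
        0.\<close>
      define n1 where "n1 = n - (e + L)"
      have n1: "n = e + L + n1" "0 < n1" "n1 \<le> k + 1"
        using False e nonneg by (auto simp: n1_def)
      have "2 * k * 0 + (2 * k + 1) * (2 * (e + L)) + (2 * k + 2) * (k + n1) = N"
        using kL[symmetric] unfolding N n1(1) by (simp add: algebra_simps)
      then show ?thesis
        by (intro disjI1 linked_split[OF u v,
              of 0 "2 * (e + L)" "k + n1" "k + 1 - n1" "2 * n1" "e + (e + L)"])
           (use n1 e ml(2) k in \<open>auto simp: share_def\<close>)
    qed
  next
    case 1
    then have x: "x = k + 1 - n" "z = k + n" "n \<le> k + 1" using ml nonneg by auto
    obtain m' l' where "p = 0 + (k + 1) * l' + m'" "b = 0 - 2 * m'" "c = z + m' - k * l'"
      using lattice_coordinates[OF r v] .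
    moreover define n' where "n' = - m'"
    ultimately have r_eq: "p = (k + 1) * l' - n'" "b = 2 * n'" "c = k + n - n' - k * l'"
      using x by auto
    have "0 \<le> (k + 1) * l'" using r_eq nonneg by simp
    then have "0 \<le> l'" using k by (simp add: zero_le_mult_iff)
    \<comment> \<open>From \<open>0 \<le> c\<close> it follows that
      \<open>k * l' \<le> k + n \<le> 2 * k + 1\<close>, which is below
      \<open>3 * k\<close>.\<close>
    have "l' \<le> 2"
    proof (rule ccontr)
      assume "\<not> ?thesis"
      then have "k * 3 \<le> k * l'" using k by (intro mult_left_mono) auto
      moreover have "k * l' \<le> 2 * k + 1" using r_eq nonneg x by simp
      ultimately show False using k by linarith
    qed
    \<comment> \<open>\<open>(1, 2k, 1)\<close> lies on the segment from \<open>(0, 2k + 2, 0)\<close> to \<open>(k + 1, 0, k + 1)\<close>\<close>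
    have middle: "linked (x, y, 0) (0, 0, z)"
      if "in_fiber (k + 1) 0 (k + 1)" "x = 0" "y = 2 * k + 2" "in_fiber 0 (2 * k + 2) 0" "z = 2 * k + 1"
    proof -
      have "k * (w2 * (2 * k + 2)) \<le> k * S"
        using that k by (intro mult_left_mono) (auto simp: in_fiber_def)
      moreover have "w1 * (k + 1) + w3 * (k + 1) \<le> S" using that by (simp add: in_fiber_def)
      ultimately have "(k + 1) * (w1 + w2 * (2 * k) + w3) \<le> (k + 1) * S"
        by (simp add: algebra_simps)
      then have "w1 + w2 * (2 * k) + w3 \<le> S"
        using k by simp
      then have "in_fiber 1 (2 * k) 1"
        using that(1) k by (simp add: in_fiber_def algebra_simps)
      then show ?thesis
        by (rule linkedI) (use that k in \<open>auto simp: share_def\<close>)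
    qed
    from \<open>0 \<le> l'\<close> \<open>l' \<le> 2\<close> consider "l' = 0" | "l' = 1" | "l' = 2" by linarith
    then show ?thesis
    proof cases
      case 1
      then have "p = 0" "b = 0" "c = z" using r_eq nonneg x by auto
      then show ?thesis by simp
    next
      case 2
      then have r1: "p = k + 1 - n'" "b = 2 * n'" "c = n - n'" using r_eq by auto
      show ?thesis
      proof (cases "n' = n")
        case True
        then show ?thesis using r1 x ml by simp
      next
        case False
        then have c: "0 < c" "0 < z" using r1 nonneg x n k by auto
        show ?thesis
        proof (cases "0 < n' \<or> n \<le> k")
          case True
          then have "share (x, y, 0) (p, b, c)" "share (p, b, c) (0, 0, z)"
            using c r1 x ml n nonneg False by (auto simp: share_def)
          then show ?thesis using linkedI r by blast
        next
          case False
          then have [simp]: "n' = 0" "n = k + 1" using r1 nonneg x by auto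
          show ?thesis
            by (intro disjI1 middle) (use r1 x ml u r in auto)
        qed
      qed
    next
      case 3
      then have r2: "p = 2 * k + 2 - n'" "b = 2 * n'" "c = n - n' - k" using r_eq by auto
      \<comment> \<open>Here \<open>0 \<le> c\<close> means \<open>n' \<le> n - k\<close>, and
        \<open>n - k \<le> 1\<close>.\<close>
      then consider "n = k" "n' = 0" | "n = k + 1" "n' = 0" | "n = k + 1" "n' = 1"
        using nonneg x by force
      then show ?thesis
      proof cases
        case 1
        \<comment> \<open>The midpoint of \<open>(0, 0, 2 * k)\<close> and
          \<open>(2 * k + 2, 0, 0)\<close>.\<close>
        have "in_fiber (k + 1) 0 k"
          using 1 r v r2 x k by (simp add: in_fiber_def algebra_simps)
        then show ?thesis
          using 1 x ml k by (intro disjI1 linkedI) (auto simp: share_def)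
      next
        case 2
        \<comment> \<open>The midpoint of \<open>(0, 0, 2 * k + 1)\<close> and
          \<open>(2 * k + 2, 0, 1)\<close>.\<close>
        have "in_fiber (k + 1) 0 (k + 1)"
          using 2 r v r2 x k by (simp add: in_fiber_def algebra_simps)
        then show ?thesis
          by (intro disjI1 middle) (use 2 x ml u in auto)
      next
        case 3
        \<comment> \<open>\<open>(2k + 1) (k, 2, k)\<close> is the sum of \<open>(x, y, 0)\<close>, \<open>k\<close> times \<open>(0, 0, z)\<close>
          and \<open>k\<close> times \<open>(p, b, c)\<close>\<close>
        have "w1 * (2 * k + 1) + w2 * 2 \<le> S" "w3 * (2 * k + 1) \<le> S"
          using 3 r v r2 x by (auto simp: in_fiber_def add.commute)
        then have "k * (w1 * (2 * k + 1) + w2 * 2) \<le> k * S" "k * (w3 * (2 * k + 1)) \<le> k * S"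
          using k by (auto intro!: mult_left_mono)
        moreover have "w2 * (2 * k + 2) \<le> S"
          using 3 u x ml by (simp add: in_fiber_def)
        ultimately have "(2 * k + 1) * (w1 * k + w2 * 2 + w3 * k) \<le> (2 * k + 1) * S"
          by (simp add: algebra_simps)
        then have "w1 * k + w2 * 2 + w3 * k \<le> S"
          using k by simp
        then have "in_fiber k 2 k"
          using 3 v x k by (simp add: in_fiber_def algebra_simps)
        then show ?thesis
          using 3 x ml k by (intro disjI1 linkedI) (auto simp: share_def)
      qed
    qed
  qed
qed

text \<open>As \<open>(p, b, c)\<close> is arbitrary, an unlinked disjoint pair is the whole fiber.
  One of two disjoint points has no \<open>y\<close>; up to order this leaves the three support
  patterns treated above.\<close>

lemma fiber_dichotomy:
  assumes u: "in_fiber x1 y1 z1" and v: "in_fiber x2 y2 z2" and r: "in_fiber p b c"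
    and "(x1, y1, z1) \<noteq> (x2, y2, z2)" "\<not> share (x1, y1, z1) (x2, y2, z2)"
  shows "linked (x1, y1, z1) (x2, y2, z2) \<or> (p, b, c) = (x1, y1, z1) \<or> (p, b, c) = (x2, y2, z2)"
proof -
  have nonneg: "0 \<le> x1" "0 \<le> y1" "0 \<le> z1" "0 \<le> x2" "0 \<le> y2" "0 \<le> z2"
    using u v by (auto simp: in_fiber_def)
  \<comment> \<open>The origin is alone in its fiber, so two distinct points both have nonempty
    support.\<close>
  have zero: "x = 0 \<and> y = 0 \<and> z = 0" if "in_fiber 0 0 0" "in_fiber x y z" for x y z
  proof -
    have nonneg: "0 \<le> x" "0 \<le> y" "0 \<le> z" and "2 * k * x + (2 * k + 1) * y + (2 * k + 2) * z = 0"
      using that unfolding in_fiber_def by auto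
    moreover have "0 \<le> 2 * k * x" "0 \<le> (2 * k + 1) * y" "0 \<le> (2 * k + 2) * z"
      using nonneg k by auto
    ultimately have "2 * k * x = 0" "(2 * k + 1) * y = 0" "(2 * k + 2) * z = 0"
      by linarith+
    then show ?thesis using k by auto
  qed
  have *: "linked (x1, 0, z1) (x2, y2, z2) \<or> (p, b, c) = (x1, 0, z1) \<or> (p, b, c) = (x2, y2, z2)"
    if u: "in_fiber x1 0 z1" and v: "in_fiber x2 y2 z2" and x: "x1 = 0 \<or> x2 = 0" and z: "z1 = 0 \<or> z2 = 0"
      and ne: "(x1, 0, z1) \<noteq> (x2, y2, z2)" for x1 z1 x2 y2 z2
  proof -
    have nonneg: "0 \<le> x1" "0 \<le> z1" "0 \<le> x2" "0 \<le> y2" "0 \<le> z2"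
      using u v by (auto simp: in_fiber_def)
    have "x1 \<noteq> 0 \<or> z1 \<noteq> 0" using zero[of x2 y2 z2] u v ne by auto
    then consider "0 < x1" "0 < z1" "x2 = 0" "z2 = 0" | "0 < x1" "z1 = 0" "x2 = 0"
      | "x1 = 0" "0 < z1" "z2 = 0" "0 < y2" | "x1 = 0" "0 < z1" "z2 = 0" "y2 = 0"
      using x z nonneg by fastforce
    then show ?thesis
    proof cases
      case 1
      then show ?thesis using fiber_y_xz[OF _ _ _ _ r, of y2 x1 z1] u v linked_commute by auto
    next
      case 2
      then show ?thesis using fiber_x_yz[OF _ _ _ r, of x1 y2 z2] u v by auto
    next
      case 3
      then show ?thesis using fiber_xy_z[OF _ _ _ r, of x2 y2 z1] u v linked_commute by auto
    next
      case 4
      then have "0 < x2" using zero[of 0 0 z1] u v nonneg by (cases "x2 = 0") auto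
      then show ?thesis using 4 fiber_x_yz[OF _ _ _ r, of x2 0 z1] u v linked_commute by auto
    qed
  qed
  have "x1 = 0 \<or> x2 = 0" "y1 = 0 \<or> y2 = 0" "z1 = 0 \<or> z2 = 0"
    using assms(5) nonneg by (auto simp: share_def)
  then show ?thesis
    using *[of x1 z1 x2 y2 z2] *[of x2 z2 x1 y1 z1] u v assms(4) linked_commute by auto
qed

end

section \<open>From monomials to lattice points\<close>

lemma var_poly_mapping_eqI:
  fixes m n :: "var \<Rightarrow>\<^sub>0 nat"
  assumes "Poly_Mapping.lookup m X = Poly_Mapping.lookup n X"
    "Poly_Mapping.lookup m Y = Poly_Mapping.lookup n Y"
    "Poly_Mapping.lookup m Z = Poly_Mapping.lookup n Z"
    "Poly_Mapping.lookup m T = Poly_Mapping.lookup n T"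
  shows "m = n"
proof (rule poly_mapping_eqI)
  fix v show "Poly_Mapping.lookup m v = Poly_Mapping.lookup n v"
    using assms by (cases v) auto
qed

lemma multidegree_\<A>:
  "multidegree (\<A> a (w1, w2, w3)) m =
    (int a * int (Poly_Mapping.lookup m X) + int (a + 1) * int (Poly_Mapping.lookup m Y)
       + int (a + 2) * int (Poly_Mapping.lookup m Z),
     int w1 * int (Poly_Mapping.lookup m X) + int w2 * int (Poly_Mapping.lookup m Y)
       + int w3 * int (Poly_Mapping.lookup m Z) + int (Poly_Mapping.lookup m T))"
proof -
  have "v \<in> {X, Y, Z, T}" for v by (cases v) auto
  then have "Poly_Mapping.keys m \<subseteq> {X, Y, Z, T}" by blast
  then show ?thesis
    by (subst multidegree_superset[of "{X, Y, Z, T}"]) (auto simp: algebra_simps)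
qed

theorem proposition4p17:
  fixes a q :: nat and w :: "nat \<times> nat \<times> nat"
  assumes "2 < a" and "a = 2 * q + 2" and "w \<noteq> (0, 0, 0)"
  shows "uniquely_presented (toric_ideal (\<A> a w) :: (var, 'k::field) mpoly set)"
proof (rule uniquely_presented_toric_ideal)
  obtain w1 w2 w3 where w: "w = (w1, w2, w3)" by (cases w)
  show "0 < fst (\<A> a w v) + snd (\<A> a w v)" for v
    using assms(1) unfolding w by (cases v) auto
  fix u v
  assume uv: "u \<noteq> v" "multidegree (\<A> a w) u = multidegree (\<A> a w) v"
    "Poly_Mapping.keys u \<inter> Poly_Mapping.keys v = {}"
  define k where "k = int q + 1"
  have k: "2 \<le> k" and a: "int a = 2 * k"
    using assms(1,2) by (auto simp: k_def)
  obtain N S where NS: "multidegree (\<A> a w) u = (N, S)" by fastforce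
  interpret weighted_fiber k "int w1" "int w2" "int w3" N S
    by unfold_locales (rule k)
  define e where "e m = (int (Poly_Mapping.lookup m X), int (Poly_Mapping.lookup m Y),
      int (Poly_Mapping.lookup m Z))" for m
  have in_fiber_e: "in_fiber (int (Poly_Mapping.lookup m X)) (int (Poly_Mapping.lookup m Y))
      (int (Poly_Mapping.lookup m Z))" if "multidegree (\<A> a w) m = (N, S)" for m
    using that unfolding w multidegree_\<A> in_fiber_def by (auto simp: a algebra_simps)
  \<comment> \<open>The degree determines the exponent of \<open>t\<close> from the other
    three.\<close>
  have e_inj: "m = n"
    if "multidegree (\<A> a w) m = (N, S)" "multidegree (\<A> a w) n = (N, S)" "e m = e n" for m n
    using that unfolding w multidegree_\<A> by (intro var_poly_mapping_eqI) (auto simp: e_def)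
  have share_e: "Poly_Mapping.keys m \<inter> Poly_Mapping.keys n \<noteq> {}" if "share (e m) (e n)" for m n
    using that by (fastforce simp: share_def e_def in_keys_iff)
  have v: "multidegree (\<A> a w) v = (N, S)" using uv NS by simp
  show "{m. multidegree (\<A> a w) m = multidegree (\<A> a w) u} = {u, v} \<or>
      (\<exists>r. multidegree (\<A> a w) r = multidegree (\<A> a w) u \<and>
        Poly_Mapping.keys u \<inter> Poly_Mapping.keys r \<noteq> {} \<and>
        Poly_Mapping.keys r \<inter> Poly_Mapping.keys v \<noteq> {})"
  proof (cases "linked (e u) (e v)")
    case True
    then obtain x y z where xyz: "in_fiber x y z" "share (e u) (x, y, z)" "share (x, y, z) (e v)"
      unfolding linked_def by blast
    \<comment> \<open>The exponent of \<open>t\<close> is the slack, which \<open>in_fiber\<close>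
      makes nonnegative, so \<open>nat\<close> loses nothing.\<close>
    define r where "r = Poly_Mapping.single X (nat x) + Poly_Mapping.single Y (nat y) +
      Poly_Mapping.single Z (nat z) +
      Poly_Mapping.single T (nat (S - (int w1 * x + int w2 * y + int w3 * z)))"
    have "e r = (x, y, z)"
      using xyz(1) by (simp add: e_def r_def lookup_add lookup_single in_fiber_def)
    moreover have "multidegree (\<A> a w) r = (N, S)"
      using xyz(1) unfolding w multidegree_\<A>
      by (simp add: r_def lookup_add lookup_single in_fiber_def a algebra_simps)
    ultimately show ?thesis
      using xyz share_e NS by metis
  next
    case False
    have "m \<in> {u, v}" if "multidegree (\<A> a w) m = (N, S)" for m
    proof -
      have "e u \<noteq> e v" using e_inj NS v uv by blast
      then have "e m = e u \<or> e m = e v"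
        using fiber_dichotomy[OF in_fiber_e[OF NS] in_fiber_e[OF v] in_fiber_e[OF that],
            folded e_def] False uv share_e
        by blast
      then show ?thesis using e_inj that NS v by blast
    qed
    then show ?thesis using NS v by auto
  qed
qed

end
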